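(* Let $\mathbf{a}=(a_1,\dots,a_n)$ and $\mathbf{b}=(b_1,\dots,b_n)$ be $n$-tuples of nonnegative reals at most one of which is degenerate. If $\eta(\mathbf{a},\mathbf{b})=(\mathbf{b}',\mathbf{a}')$, then $$M(\mathbf{a})M(\mathbf{b})=M(\mathbf{b}')M(\mathbf{a}')\qquad\text{and}\qquad N(\mathbf{b})N(\mathbf{a})=N(\mathbf{a}')N(\mathbf{b}').$$
   Context: Fix $n\ge1$; indices of parameters are read modulo $n$. An $n$-tuple $\mathbf{a}\in\mathbb{R}_{\ge0}^n$ is degenerate if at least one $a_i$ is $0$. Define $$\kappa_i(\mathbf{a},\mathbf{b})=\sum_{j=i}^{i+n-1}\ \prod_{k=i+1}^{j}b_k\prod_{k=j+1}^{i+n-1}a_k .$$ For $(\mathbf{a},\mathbf{b})$ with at most one of $\mathbf{a},\mathbf{b}$ degenerate, $\eta(\mathbf{a},\mathbf{b})=(\mathbf{b}',\mathbf{a}')$ where $$b'_i=\frac{b_{i+1}\kappa_{i+1}(\mathbf{a},\mathbf{b})}{\kappa_i(\mathbf{a},\mathbf{b})},\qquad a'_i=\frac{a_{i-1}\kappa_{i-1}(\mathbf{a},\mathbf{b})}{\kappa_i(\mathbf{a},\mathbf{b})}.$$ The whirl $M(\mathbf{a})$ is the doubly infinite matrix (indexed by $\mathbb{Z}\times\mathbb{Z}$) with $m_{i,i}=1$, $m_{i,i+1}=a_i$, other entries $0$. The curl $N(\mathbf{a})$ is the doubly infinite upper triangular matrix with $1$'s on the diagonal and $(i,j)$ entry $a_ia_{i+1}\cdots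 a_{j-1}$ for $i<j$. *)

theory Defs
  imports Complex_Main "HOL-Library.Groups_Big_Fun"
begin

text \<open>An n-tuple \<open>(a\<^sub>1, \<dots>, a\<^sub>n)\<close> of reals is a list of length n. The entry with integer index i,
  read modulo n, is \<open>entry a i\<close>; indices start at 1, so \<open>entry a 1\<close> is the head of the list.\<close>

definition entry :: "real list \<Rightarrow> int \<Rightarrow> real" where
  "entry a i = a ! nat ((i - 1) mod int (length a))"

definition degenerate :: "real list \<Rightarrow> bool" where
  "degenerate a \<longleftrightarrow> (\<exists>x \<in> set a. x = 0)"

text \<open>\<open>kappa\<close> and \<open>eta\<close> are only meant for two tuples of the same length n; n is taken from the first.\<close>

definition kappa :: "real list \<Rightarrow> real list \<Rightarrow> int \<Rightarrow> real" where
  "kappa a b i = (\<Sum>j = i..i + int (length a) - 1.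
     (\<Prod>k = i + 1..j. entry b k) * (\<Prod>k = j + 1..i + int (length a) - 1. entry a k))"

definition eta :: "real list \<Rightarrow> real list \<Rightarrow> real list \<times> real list" where
  "eta a b =
     (map (\<lambda>i. entry b (i + 1) * kappa a b (i + 1) / kappa a b i) [1..int (length a)],
      map (\<lambda>i. entry a (i - 1) * kappa a b (i - 1) / kappa a b i) [1..int (length a)])"

type_synonym inf_matrix = "int \<Rightarrow> int \<Rightarrow> real"

definition whirl :: "real list \<Rightarrow> inf_matrix" where
  "whirl a i j = (if j = i then 1 else if j = i + 1 then entry a i else 0)"

definition curl :: "real list \<Rightarrow> inf_matrix" where
  "curl a i j = (if j = i then 1 else if i < j then (\<Prod>k = i..j - 1. entry a k) else 0)"

text \<open>\<^const>\<open>Sum_any\<close> is 0 when infinitely many summands are nonzero. This does not happen for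
  upper triangular matrices, in particular for whirls and curls; see the lemmas below.\<close>

definition inf_mult :: "inf_matrix \<Rightarrow> inf_matrix \<Rightarrow> inf_matrix"  (infixl "\<odot>" 70) where
  "(A \<odot> B) i j = Sum_any (\<lambda>k. A i k * B k j)"

definition upper_triangular :: "inf_matrix \<Rightarrow> bool" where
  "upper_triangular A \<longleftrightarrow> (\<forall>i j. j < i \<longrightarrow> A i j = 0)"

lemma upper_triangular_whirl: "upper_triangular (whirl a)"
  by (auto simp: upper_triangular_def whirl_def)

lemma upper_triangular_curl: "upper_triangular (curl a)"
  by (auto simp: upper_triangular_def curl_def)

lemma inf_mult_upper_triangular:
  assumes "upper_triangular A" and "upper_triangular B"
  shows "finite {k. A i k * B k j \<noteq> 0}"
    and "(A \<odot> B) i j = (\<Sum>k = i..j. A i k * B k j)"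
proof -
  have sub: "{k. A i k * B k j \<noteq> 0} \<subseteq> {i..j}"
    using assms by (force simp: upper_triangular_def not_le[symmetric])
  then show "finite {k. A i k * B k j \<noteq> 0}"
    by (rule finite_subset) simp
  show "(A \<odot> B) i j = (\<Sum>k = i..j. A i k * B k j)"
    unfolding inf_mult_def by (rule Sum_any.expand_superset) (use sub in simp_all)
qed

end

theory Submission
  imports Defs
begin

text \<open>The products \<open>M(a) M(b)\<close> and \<open>N(b) N(a)\<close> depend on the tuples only through the numbers
  \<open>a\<^sub>i + b\<^sub>i\<close> and \<open>a\<^sub>i b\<^sub>i\<^sub>+\<^sub>1\<close>. For whirls these are the entries on the two superdiagonals of
  \<open>M(a) M(b)\<close>. For curls they are the coefficients of a recursion: since \<open>N(a)\<close> is the inverse of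
  \<open>M(-a)\<close>, the product \<open>X = N(b) N(a)\<close> is the inverse of \<open>M(-a) M(-b)\<close>, which means
  \<open>X\<^sub>i\<^sub>j = \<delta>\<^sub>i\<^sub>j + (a\<^sub>i + b\<^sub>i) X\<^bsub>i+1,j\<^esub> - a\<^sub>i b\<^sub>i\<^sub>+\<^sub>1 X\<^bsub>i+2,j\<^esub>\<close>, and this determines an upper triangular \<open>X\<close>
  column by column, from the diagonal upwards (lemmas \<open>whirl_mult_cong\<close> and \<open>curl_mult_cong\<close>).

  So \<open>\<eta>\<close> only has to preserve these two families of numbers. As not both tuples are degenerate, all
  \<open>\<kappa>\<^sub>i\<close> are positive (lemma \<open>kappa_pos\<close>), so division by them is harmless. In \<open>b'\<^sub>i a'\<^sub>i\<^sub>+\<^sub>1\<close> the factors \<open>\<kappa>\<close>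
  cancel. Preservation of the sums amounts to
  \<open>b\<^sub>i\<^sub>+\<^sub>1 \<kappa>\<^sub>i\<^sub>+\<^sub>1 - a\<^sub>i \<kappa>\<^sub>i = b\<^sub>i \<kappa>\<^sub>i - a\<^sub>i\<^sub>-\<^sub>1 \<kappa>\<^sub>i\<^sub>-\<^sub>1\<close>, that is, to the left-hand side being independent of
  \<open>i\<close>; by telescoping it equals \<open>b\<^sub>1 \<cdots> b\<^sub>n - a\<^sub>1 \<cdots> a\<^sub>n\<close> (lemma \<open>kappa_step\<close>).\<close>

section \<open>Products of whirls and of curls\<close>

lemma whirl_inf_mult: "(whirl a \<odot> Q) i j = Q i j + entry a i * Q (i + 1) j"
proof -
  have "(whirl a \<odot> Q) i j = (\<Sum>k\<in>{i, i + 1}. whirl a i k * Q k j)"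
    unfolding inf_mult_def by (rule Sum_any.expand_superset) (auto simp: whirl_def)
  then show ?thesis by (simp add: whirl_def)
qed

lemma whirl_mult_cong:
  assumes "\<And>i. entry a i + entry b i = entry c i + entry d i"
    and "\<And>i. entry a i * entry b (i + 1) = entry c i * entry d (i + 1)"
  shows "whirl a \<odot> whirl b = whirl c \<odot> whirl d"
proof (intro ext)
  fix i j
  show "(whirl a \<odot> whirl b) i j = (whirl c \<odot> whirl d) i j"
    using assms[of i] unfolding whirl_inf_mult by (auto simp: whirl_def add_ac)
qed

lemma curl_rec: "curl a i j = (if i = j then 1 else 0) + entry a i * curl a (i + 1) j"
proof (cases "i < j")
  case True
  then have "{i..j - 1} = insert i {i + 1..j - 1}" by auto
  with True show ?thesis by (auto simp: curl_def)
qed (auto simp: curl_def)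

lemma curl_inf_mult_rec:
  assumes "upper_triangular P"
  shows "(curl b \<odot> P) i j = P i j + entry b i * (curl b \<odot> P) (i + 1) j"
proof (cases "i \<le> j")
  case True
  have *: "(curl b \<odot> P) i j = (\<Sum>k = i..j. curl b i k * P k j)" for i
    by (rule inf_mult_upper_triangular(2)[OF upper_triangular_curl assms])
  have "{i..j} = insert i {i + 1..j}" using True by auto
  then have "(curl b \<odot> P) i j = P i j + (\<Sum>k = i + 1..j. curl b i k * P k j)"
    unfolding * by (simp add: curl_def)
  also have "(\<Sum>k = i + 1..j. curl b i k * P k j)
      = (\<Sum>k = i + 1..j. entry b i * (curl b (i + 1) k * P k j))"
    by (intro sum.cong refl) (subst curl_rec, auto)
  finally show ?thesis unfolding * sum_distrib_left .
next
  case False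
  then show ?thesis
    using assms by (simp add: inf_mult_upper_triangular(2)[OF upper_triangular_curl assms]
        upper_triangular_def)
qed

lemma curl_mult_curl_rec:
  "(curl b \<odot> curl a) i j = (if i = j then 1 else 0)
     + (entry a i + entry b i) * (curl b \<odot> curl a) (i + 1) j
     - entry a i * entry b (i + 1) * (curl b \<odot> curl a) (i + 2) j"
proof -
  have 1: "(curl b \<odot> curl a) i j = curl a i j + entry b i * (curl b \<odot> curl a) (i + 1) j"
    by (rule curl_inf_mult_rec[OF upper_triangular_curl])
  have 2: "curl a (i + 1) j
      = (curl b \<odot> curl a) (i + 1) j - entry b (i + 1) * (curl b \<odot> curl a) (i + 2) j"
    using curl_inf_mult_rec[OF upper_triangular_curl, of b a "i + 1" j] by (simp add: add_ac)
  show ?thesis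
    unfolding 1 curl_rec[of a i] 2 by (simp add: algebra_simps)
qed

text \<open>The recursion expresses row \<open>i\<close> through rows \<open>i + 1\<close> and \<open>i + 2\<close>, and all rows \<open>i > j\<close> vanish in
  column \<open>j\<close>, so induction on \<open>j + 1 - i\<close>, cut off at 0, applies.\<close>

lemma curl_mult_cong:
  assumes "\<And>i. entry a i + entry b i = entry c i + entry d i"
    and "\<And>i. entry a i * entry b (i + 1) = entry c i * entry d (i + 1)"
  shows "curl b \<odot> curl a = curl d \<odot> curl c"
proof (intro ext)
  fix i j
  show "(curl b \<odot> curl a) i j = (curl d \<odot> curl c) i j"
  proof (induction "nat (j + 1 - i)" arbitrary: i rule: less_induct)
    case less
    show ?case
    proof (cases "i \<le> j")
      case True
      then show ?thesis
        by (subst (1 2) curl_mult_curl_rec) (simp add: less assms)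
    next
      case False
      then show ?thesis
        by (simp add: inf_mult_upper_triangular(2)[OF upper_triangular_curl upper_triangular_curl])
    qed
  qed
qed

section \<open>Periodicity\<close>

lemma entry_add_mult_length: "entry a (i + m * int (length a)) = entry a i"
  unfolding entry_def by (metis add_diff_eq diff_add_eq mod_mult_self1)

lemma entry_in_set:
  assumes "a \<noteq> []"
  shows "entry a i \<in> set a"
  using assms by (simp add: entry_def nat_less_iff)

lemma prod_shift_int: "(\<Prod>k = l + s..u + s. f k) = (\<Prod>k = l..(u::int). f (k + s))"
  by (rule prod.reindex_bij_witness[of _ "\<lambda>k. k + s" "\<lambda>k. k - s"]) auto

lemma kappa_add_mult_length:
  assumes len: "length b = length a"
  shows "kappa a b (i + m * int (length a)) = kappa a b i"
proof -
  let ?n = "int (length a)"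
  let ?s = "m * ?n"
  have a: "entry a (k + ?s) = entry a k" for k
    by (rule entry_add_mult_length)
  have b: "entry b (k + ?s) = entry b k" for k
    using entry_add_mult_length[of b] len by simp
  have "kappa a b (i + ?s) = (\<Sum>j = i..i + ?n - 1. (\<Prod>k = i + 1 + ?s..j + ?s. entry b k)
      * (\<Prod>k = j + 1 + ?s..i + ?n - 1 + ?s. entry a k))"
    unfolding kappa_def
    by (rule sum.reindex_bij_witness[of _ "\<lambda>k. k + ?s" "\<lambda>k. k - ?s"]) (auto simp: algebra_simps)
  then show ?thesis
    unfolding prod_shift_int a b kappa_def .
qed

lemma entry_map_upto:
  assumes "n \<ge> 1" and periodic: "\<And>i m. f (i + m * int n) = f i"
  shows "entry (map f [1..int n]) i = f i"
proof -
  define r where "r = (i - 1) mod int n"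
  have r: "0 \<le> r" "r < int n"
    using assms(1) by (simp_all add: r_def)
  have "i = 1 + r + ((i - 1) div int n) * int n"
    unfolding r_def using div_mult_mod_eq[of "i - 1" "int n"] by linarith
  then have "f i = f (1 + r)"
    using periodic by metis
  moreover have "entry (map f [1..int n]) i = f (1 + r)"
    using r by (simp add: entry_def r_def[symmetric] nat_less_iff)
  ultimately show ?thesis by simp
qed

section \<open>The functions kappa\<close>

text \<open>Put \<open>T\<^sub>j = (\<Prod>k = i+1..j. b\<^sub>k) (\<Prod>k = j+1..i+n. a\<^sub>k)\<close>. By periodicity \<open>a\<^sub>i \<kappa>\<^sub>i\<close> is the sum of
  \<open>T\<^sub>i, \<dots>, T\<^sub>i\<^sub>+\<^sub>n\<^sub>-\<^sub>1\<close>, and \<open>b\<^sub>i\<^sub>+\<^sub>1 \<kappa>\<^sub>i\<^sub>+\<^sub>1\<close> is the sum of \<open>T\<^sub>i\<^sub>+\<^sub>1, \<dots>, T\<^sub>i\<^sub>+\<^sub>n\<close>, so only \<open>T\<^sub>i\<^sub>+\<^sub>n - T\<^sub>i\<close> survives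
  in the difference.\<close>

lemma kappa_step:
  assumes "a \<noteq> []" and len: "length b = length a"
  defines "n \<equiv> int (length a)"
  shows "entry b (i + 1) * kappa a b (i + 1) - entry a i * kappa a b i
       = (\<Prod>k = i + 1..i + n. entry b k) - (\<Prod>k = i + 1..i + n. entry a k)"
proof -
  have n: "n \<ge> 1" using assms(1) by (simp add: n_def Suc_le_eq)
  define T where
    "T j = (\<Prod>k = i + 1..j. entry b k) * (\<Prod>k = j + 1..i + n. entry a k)" for j
  have a_top: "entry a (i + n) = entry a i"
    using entry_add_mult_length[of a i 1] by (simp add: n_def)
  have "entry a i * kappa a b i = (\<Sum>j = i..i + n - 1. T j)"
    unfolding kappa_def n_def[symmetric] sum_distrib_left
  proof (rule sum.cong)
    fix j assume "j \<in> {i..i + n - 1}"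
    then have "{j + 1..i + n} = insert (i + n) {j + 1..i + n - 1}" by auto
    then show "entry a i * ((\<Prod>k = i + 1..j. entry b k) * (\<Prod>k = j + 1..i + n - 1. entry a k)) = T j"
      by (simp add: T_def a_top)
  qed simp
  also have "{i..i + n - 1} = insert i {i + 1..i + n - 1}" using n by auto
  finally have A: "entry a i * kappa a b i = T i + (\<Sum>j = i + 1..i + n - 1. T j)" by simp
  have "entry b (i + 1) * kappa a b (i + 1) = (\<Sum>j = i + 1..i + n. T j)"
    unfolding kappa_def n_def[symmetric] sum_distrib_left
  proof (rule sum.cong)
    fix j assume "j \<in> {i + 1..i + n}"
    then have "{i + 1..j} = insert (i + 1) {i + 1 + 1..j}" by auto
    then show "entry b (i + 1) * ((\<Prod>k = i + 1 + 1..j. entry b k)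
        * (\<Prod>k = j + 1..i + 1 + n - 1. entry a k)) = T j"
      by (simp add: T_def add_ac)
  qed simp
  also have "{i + 1..i + n} = insert (i + n) {i + 1..i + n - 1}" using n by auto
  finally have "entry b (i + 1) * kappa a b (i + 1) = T (i + n) + (\<Sum>j = i + 1..i + n - 1. T j)"
    by simp
  with A show ?thesis by (simp add: T_def)
qed

lemma prod_period:
  assumes "a \<noteq> []"
  shows "(\<Prod>k = i + 1..i + int (length a). entry a k) = (\<Prod>k = i..i + int (length a) - 1. entry a k)"
proof -
  let ?n = "int (length a)"
  have n: "?n \<ge> 1" using assms by (simp add: Suc_le_eq)
  have "{i + 1..i + ?n} = insert (i + ?n) {i + 1..i + ?n - 1}"
    and "{i..i + ?n - 1} = insert i {i + 1..i + ?n - 1}"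
    using n by auto
  then show ?thesis
    using entry_add_mult_length[of a i 1] by simp
qed

lemma kappa_rec:
  assumes "a \<noteq> []" and len: "length b = length a"
  shows "entry b (i + 1) * kappa a b (i + 1) + entry a (i - 1) * kappa a b (i - 1)
       = (entry a i + entry b i) * kappa a b i"
proof -
  have "b \<noteq> []" using assms by auto
  from kappa_step[OF assms, of i] kappa_step[OF assms, of "i - 1"]
    prod_period[OF assms(1), of i] prod_period[OF this, of i]
  show ?thesis by (simp add: len algebra_simps)
qed

text \<open>All summands of \<open>\<kappa>\<^sub>i\<close> are nonnegative. The first one is a product of entries of \<open>a\<close> only, the last
  one of entries of \<open>b\<close> only, so one of these two is positive.\<close>

lemma kappa_pos:
  assumes "a \<noteq> []" and len: "length b = length a"
    and nonneg: "\<forall>x \<in> set a. x \<ge> 0" "\<forall>x \<in> set b. x \<ge> 0"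
    and nondeg: "\<not> (degenerate a \<and> degenerate b)"
  shows "kappa a b i > 0"
proof -
  have "b \<noteq> []" using assms by auto
  have a: "entry a k \<ge> 0" and b: "entry b k \<ge> 0" for k
    using entry_in_set[OF \<open>a \<noteq> []\<close>] entry_in_set[OF \<open>b \<noteq> []\<close>] nonneg by auto
  have n: "int (length a) \<ge> 1" using assms(1) by (simp add: Suc_le_eq)
  have pos: "(\<forall>k. entry a k > 0) \<or> (\<forall>k. entry b k > 0)"
    using nondeg a b entry_in_set[OF \<open>a \<noteq> []\<close>] entry_in_set[OF \<open>b \<noteq> []\<close>]
    unfolding degenerate_def by (metis less_eq_real_def)
  then obtain j where "j \<in> {i..i + int (length a) - 1}"
    "(\<Prod>k = i + 1..j. entry b k) * (\<Prod>k = j + 1..i + int (length a) - 1. entry a k) > 0"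
  proof
    assume "\<forall>k. entry a k > 0"
    then show ?thesis using n by (intro that[of i]) (auto intro!: prod_pos)
  next
    assume "\<forall>k. entry b k > 0"
    then show ?thesis using n
      by (intro that[of "i + int (length a) - 1"]) (auto intro!: prod_pos)
  qed
  then show ?thesis
    unfolding kappa_def
    by (intro sum_pos2[of _ j]) (auto intro!: mult_nonneg_nonneg prod_nonneg simp: a b)
qed

section \<open>The map eta preserves both products\<close>

lemma entry_eta:
  assumes "a \<noteq> []" and len: "length b = length a" and "eta a b = (b', a')"
  shows "entry b' i = entry b (i + 1) * kappa a b (i + 1) / kappa a b i"
    and "entry a' i = entry a (i - 1) * kappa a b (i - 1) / kappa a b i"
proof -
  let ?n = "int (length a)"
  have n: "length a \<ge> 1" using assms(1) by (simp add: Suc_le_eq)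
  have k: "kappa a b (i + m * ?n + 1) = kappa a b (i + 1)"
    "kappa a b (i + m * ?n - 1) = kappa a b (i - 1)"
    "kappa a b (i + m * ?n) = kappa a b i" for i m
    using kappa_add_mult_length[OF len, of "i + 1" m] kappa_add_mult_length[OF len, of "i - 1" m]
      kappa_add_mult_length[OF len, of i m] by (simp_all add: algebra_simps)
  have e: "entry b (i + m * ?n + 1) = entry b (i + 1)"
    "entry a (i + m * ?n - 1) = entry a (i - 1)" for i m
    using entry_add_mult_length[of b "i + 1" m] entry_add_mult_length[of a "i - 1" m] len
    by (simp_all add: algebra_simps)
  have b': "b' = map (\<lambda>i. entry b (i + 1) * kappa a b (i + 1) / kappa a b i) [1..?n]"
    and a': "a' = map (\<lambda>i. entry a (i - 1) * kappa a b (i - 1) / kappa a b i) [1..?n]"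
    using assms(3) by (simp_all add: eta_def)
  show "entry b' i = entry b (i + 1) * kappa a b (i + 1) / kappa a b i"
    unfolding b' by (rule entry_map_upto[OF n]) (simp only: k e)
  show "entry a' i = entry a (i - 1) * kappa a b (i - 1) / kappa a b i"
    unfolding a' by (rule entry_map_upto[OF n]) (simp only: k e)
qed

theorem theorem6p2:
  fixes n :: nat and a b a' b' :: "real list"
  assumes "n \<ge> 1"
    and "length a = n" and "length b = n"
    and "\<forall>x \<in> set a. x \<ge> 0" and "\<forall>x \<in> set b. x \<ge> 0"
    and "\<not> (degenerate a \<and> degenerate b)"
    and "eta a b = (b', a')"
  shows "whirl a \<odot> whirl b = whirl b' \<odot> whirl a' \<and> curl b \<odot> curl a = curl a' \<odot> curl b'"
proof -
  have ne: "a \<noteq> []" and len: "length b = length a"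
    using assms(1-3) by auto
  have pos: "kappa a b i > 0" for i
    by (rule kappa_pos[OF ne len assms(4-6)])
  note entries = entry_eta[OF ne len assms(7)]
  have sum: "entry a i + entry b i = entry b' i + entry a' i" for i
    using pos[of i] kappa_rec[OF ne len, of i]
    by (simp add: entries add_divide_distrib[symmetric])
  have prod: "entry a i * entry b (i + 1) = entry b' i * entry a' (i + 1)" for i
    using pos[of i] pos[of "i + 1"] by (simp add: entries)
  show ?thesis
    using whirl_mult_cong[of a b b' a', OF sum prod] curl_mult_cong[of a b b' a', OF sum prod] ..
qed

end
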